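(* Let $ABC$ be a triangle with circumcircle $\Omega$, let $P$ be a point with isogonal conjugate $P'$ with respect to $ABC$, and let $D$ be the intersection of $\Omega$ with the conic $(ABCPP')$ other than $A,B,C$. Let $X$ be the second intersection of line $DP$ with $\Omega$ and $Y$ the second intersection of line $DP'$ with $\Omega$. Let the circle $(PXY)$ meet line $PP'$ again at $Z$. (a) The circle $(PXY)$ and the conic $(ABCPZ)$ are tangent at $P$ and at $Z$. (b) Let the circle $(PXY)$ meet the conic $(ABCPX)$ at the points $Z_1, Z_2$ (other than $P, X$). Let lines $XZ_1, XZ_2$ meet $\Omega$ again at $Z_1', Z_2'$ respectively. Then line $Z_1'Z_2'$ is tangent to the conic $(ABCPP')$ at $P'$.
   Context: For points $X,Y,Z$, $(XYZ)$ denotes the circle through them; for five points $V,W,X,Y,Z$, $(VWXYZ)$ denotes the conic through them. *)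

theory Defs
  imports "HOL-Analysis.Analysis"
begin

text \<open>Points of the real plane are complex numbers.  A conic (or circle) is given by the
coefficients (a,b,c,d,e,f) of  a x^2 + b x y + c y^2 + d x + e y + f = 0.\<close>

type_synonym conic = "real \<times> real \<times> real \<times> real \<times> real \<times> real"

definition on_conic :: "conic \<Rightarrow> complex \<Rightarrow> bool" where
  "on_conic K z = (case K of (a,b,c,d,e,f) \<Rightarrow>
     a * (Re z)^2 + b * Re z * Im z + c * (Im z)^2 + d * Re z + e * Im z + f = 0)"

definition is_conic :: "conic \<Rightarrow> bool" where
  "is_conic K = (case K of (a,b,c,d,e,f) \<Rightarrow> (a,b,c) \<noteq> (0,0,0))"

definition is_circle :: "conic \<Rightarrow> bool" where
  "is_circle K = (case K of (a,b,c,d,e,f) \<Rightarrow> a \<noteq> 0 \<and> a = c \<and> b = 0 \<and> d^2 + e^2 > 4*a*f)"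

definition conic_scale :: "real \<Rightarrow> conic \<Rightarrow> conic" where
  "conic_scale t K = (case K of (a,b,c,d,e,f) \<Rightarrow> (t*a,t*b,t*c,t*d,t*e,t*f))"

definition conic_grad :: "conic \<Rightarrow> complex \<Rightarrow> complex" where
  "conic_grad K z = (case K of (a,b,c,d,e,f) \<Rightarrow>
     Complex (2*a*Re z + b*Im z + d) (b*Re z + 2*c*Im z + e))"

definition unique_conic5 :: "complex \<Rightarrow> complex \<Rightarrow> complex \<Rightarrow> complex \<Rightarrow> complex \<Rightarrow> bool" where
  "unique_conic5 p1 p2 p3 p4 p5 =
     ((\<exists>K. is_conic K \<and> (\<forall>p\<in>{p1,p2,p3,p4,p5}. on_conic K p)) \<and>
      (\<forall>K1 K2. is_conic K1 \<and> is_conic K2 \<and> (\<forall>p\<in>{p1,p2,p3,p4,p5}. on_conic K1 p) \<and>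
               (\<forall>p\<in>{p1,p2,p3,p4,p5}. on_conic K2 p) \<longrightarrow> (\<exists>t. t \<noteq> 0 \<and> K2 = conic_scale t K1)))"

text \<open>Two curves are tangent at p: both pass through p and their gradients at p are
  linearly dependent (intersection multiplicity at least 2).\<close>
definition curves_tangent_at :: "conic \<Rightarrow> conic \<Rightarrow> complex \<Rightarrow> bool" where
  "curves_tangent_at K1 K2 p = (on_conic K1 p \<and> on_conic K2 p \<and>
      Im (cnj (conic_grad K1 p) * conic_grad K2 p) = 0)"

definition line_tangent_at :: "complex \<Rightarrow> complex \<Rightarrow> conic \<Rightarrow> complex \<Rightarrow> bool" where
  "line_tangent_at u v K p = (u \<noteq> v \<and> collinear {u, v, p} \<and> on_conic K p \<and>
      Re (cnj (conic_grad K p) * (v - u)) = 0)"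

definition reflect_line :: "complex \<Rightarrow> complex \<Rightarrow> complex \<Rightarrow> complex" where
  "reflect_line Q w z = Q + (w / cnj w) * cnj (z - Q)"

definition bisector_dir :: "complex \<Rightarrow> complex \<Rightarrow> complex \<Rightarrow> complex" where
  "bisector_dir V U W = (U - V) / of_real (cmod (U - V)) + (W - V) / of_real (cmod (W - V))"

definition isogonal_conj :: "complex \<Rightarrow> complex \<Rightarrow> complex \<Rightarrow> complex \<Rightarrow> complex \<Rightarrow> bool" where
  "isogonal_conj A B C P P' =
     (collinear {A, reflect_line A (bisector_dir A B C) P, P'} \<and>
      collinear {B, reflect_line B (bisector_dir B C A) P, P'} \<and>
      collinear {C, reflect_line C (bisector_dir C A B) P, P'})"

end

theory Submission
  imports Defs
begin

text \<open>Choose coordinates in which \<open>\<Omega>\<close> is the unit circle and \<open>D = 1\<close>, and write a conic as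
\<open>2 Re (\<alpha> z\<^sup>2) + \<beta> |z|\<^sup>2 + 2 Re (\<gamma> z) + \<delta> = 0\<close>. On the unit circle this is the quartic
\<open>\<alpha> z\<^sup>4 + \<gamma> z\<^sup>3 + (\<beta> + \<delta>) z\<^sup>2 + \<gamma>~ z + \<alpha>~ = 0\<close>, where \<open>z~\<close> denotes the conjugate of \<open>z\<close>, so
Vieta's formulas express a circumconic through the elementary symmetric functions \<open>s1, s2, s3\<close> of
the vertices and its fourth intersection \<open>d\<close> with the circle. Isogonality of \<open>p\<close> and \<open>q\<close> is the
equation \<open>p + q + s3 p~ q~ = s1\<close>, and then the circumconic passes through \<open>p\<close> iff
\<open>\<beta> = \<alpha> (s3 q~ + d q)\<close>. Since \<open>Q\<close> contains both \<open>p\<close> and \<open>q\<close>, with \<open>d = 1\<close>, the difference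
\<open>w = p - q\<close> satisfies \<open>s3 w~ = - w\<close>.

For (a), a combination of the circle \<open>\<Gamma> = (PXY)\<close> and the doubled line \<open>PP'\<close> vanishes at the
vertices; it has double contact with \<open>\<Gamma>\<close> at \<open>P\<close> and \<open>Z\<close>, so by uniqueness it is the conic
\<open>(ABCPZ)\<close>. For (b), projection of \<open>\<Gamma>\<close> from \<open>X\<close> to \<open>\<Omega>\<close> is a similarity. It moves the conic
\<open>(ABCPX)\<close> to a conic that meets \<open>\<Omega>\<close> in the images of \<open>P\<close> and \<open>X\<close> and in \<open>Z1'\<close> and \<open>Z2'\<close>, and
Vieta's formulas give the sum and the product of the latter two.\<close>

subsection \<open>Collinearity and isogonality in complex coordinates\<close>

lemma cmod_eq_1_iff: "cmod z = 1 \<longleftrightarrow> z * cnj z = 1"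
proof -
  have "cmod z = 1 \<longleftrightarrow> (cmod z)^2 = 1" using power2_eq_iff_nonneg[of "cmod z" 1] by simp
  also have "\<dots> \<longleftrightarrow> z * cnj z = 1"
    unfolding complex_norm_square[symmetric] by (rule of_real_eq_1_iff[symmetric])
  finally show ?thesis .
qed

lemma divide_in_Reals_iff:
  fixes z w :: complex
  assumes "w \<noteq> 0"
  shows "z / w \<in> \<real> \<longleftrightarrow> w * cnj z = cnj w * z"
  using assms by (auto simp: Reals_cnj_iff field_simps)

lemma collinear_complex_iff:
  fixes u v w :: complex
  shows "collinear {u, v, w} \<longleftrightarrow> (v - u) * cnj (w - u) = cnj (v - u) * (w - u)"
proof -
  have "collinear {u, v, w} \<longleftrightarrow> collinear {0, v - u, w - u}"
    using collinear_3[of v u w] by (simp only: NO_MATCH_def insert_commute[of u v] simp_thms)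
  also have "\<dots> \<longleftrightarrow> (w - u) / (v - u) \<in> \<real>" by (rule collinear_iff_Reals)
  also have "\<dots> \<longleftrightarrow> (v - u) * cnj (w - u) = cnj (v - u) * (w - u)"
    by (cases "v = u") (simp_all add: divide_in_Reals_iff)
  finally show ?thesis .
qed

lemma collinear_unit_chord_iff:
  fixes d x p :: complex
  assumes "cmod d = 1" "cmod x = 1" "d \<noteq> x"
  shows "collinear {d, x, p} \<longleftrightarrow> p + d * x * cnj p = d + x"
proof -
  have unit: "d * cnj d = 1" "x * cnj x = 1" using assms(1,2) by (simp_all add: cmod_eq_1_iff)
  hence nz: "d * x \<noteq> 0" by auto
  have "d * x * ((x - d) * cnj (p - d) - cnj (x - d) * (p - d))
      = (x - d) * (p + d * x * cnj p - (d + x))"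
    using unit unfolding complex_cnj_diff by algebra
  hence "(x - d) * cnj (p - d) = cnj (x - d) * (p - d) \<longleftrightarrow> p + d * x * cnj p = d + x"
    using nz assms(3) by (metis eq_iff_diff_eq_0 mult_eq_0_iff)
  thus ?thesis by (simp only: collinear_complex_iff)
qed

lemma reflection_ratio:
  assumes "cmod U = 1" "cmod V = 1" "U + V \<noteq> 0"
  shows "(U + V) / cnj (U + V) = U * V"
proof -
  have "U + V = U * V * cnj (U + V)"
    using assms(1,2) unfolding cmod_eq_1_iff complex_cnj_add by algebra
  thus ?thesis using assms(3) by (metis complex_cnj_zero_iff nonzero_divide_eq_eq)
qed

lemma isogonal_line_iff:
  fixes A B C P P' :: complex
  assumes "\<not> collinear {A, B, C}"
  shows "collinear {A, reflect_line A (bisector_dir A B C) P, P'}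
    \<longleftrightarrow> (P - A) * (P' - A) / ((B - A) * (C - A)) \<in> \<real>"
proof -
  define m n U V where "m = cmod (B - A)" and "n = cmod (C - A)"
    and "U = sgn (B - A)" and "V = sgn (C - A)"
  have neq: "B \<noteq> A" "C \<noteq> A" using assms by (auto simp: insert_commute)
  hence UV: "cmod U = 1" "cmod V = 1" by (simp_all add: U_def V_def norm_sgn)
  have mn: "m \<noteq> 0" "n \<noteq> 0" using neq by (simp_all add: m_def n_def)
  have BC: "B - A = of_real m * U" "C - A = of_real n * V"
    using neq by (simp_all add: m_def n_def U_def V_def sgn_eq)
  have "U + V \<noteq> 0"
  proof
    assume "U + V = 0"
    hence "V = - U" by algebra
    hence "collinear {A, B, C}" unfolding collinear_complex_iff BC by simp
    thus False using assms by simp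
  qed
  moreover have "bisector_dir A B C = U + V" by (simp add: bisector_dir_def U_def V_def sgn_eq)
  ultimately have "reflect_line A (bisector_dir A B C) P - A = U * V * cnj (P - A)"
    using reflection_ratio[OF UV] by (simp add: reflect_line_def)
  hence "collinear {A, reflect_line A (bisector_dir A B C) P, P'}
      \<longleftrightarrow> U * V * cnj ((P - A) * (P' - A)) = cnj (U * V) * ((P - A) * (P' - A))"
    unfolding collinear_complex_iff by (simp add: mult_ac)
  also have "\<dots> \<longleftrightarrow> (B - A) * (C - A) * cnj ((P - A) * (P' - A))
      = cnj ((B - A) * (C - A)) * ((P - A) * (P' - A))"
    using mn unfolding BC by (simp add: mult_ac)
  also have "\<dots> \<longleftrightarrow> (P - A) * (P' - A) / ((B - A) * (C - A)) \<in> \<real>"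
    using neq by (simp add: divide_in_Reals_iff)
  finally show ?thesis .
qed

lemma isogonal_conj_iff:
  fixes A B C P P' :: complex
  assumes "\<not> collinear {A, B, C}"
  shows "isogonal_conj A B C P P' \<longleftrightarrow>
    (P - A) * (P' - A) / ((B - A) * (C - A)) \<in> \<real> \<and>
    (P - B) * (P' - B) / ((C - B) * (A - B)) \<in> \<real> \<and>
    (P - C) * (P' - C) / ((A - C) * (B - C)) \<in> \<real>"
  using isogonal_line_iff[of A B C P P'] isogonal_line_iff[of B C A P P']
    isogonal_line_iff[of C A B P P'] assms
  by (simp add: isogonal_conj_def insert_commute)

lemma isogonal_conj_commute:
  assumes "\<not> collinear {A, B, C}"
  shows "isogonal_conj A B C P P' \<longleftrightarrow> isogonal_conj A B C P' P"
  using assms by (simp add: isogonal_conj_iff mult.commute)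

subsection \<open>Conics in complex coordinates\<close>

definition conic_eval :: "conic \<Rightarrow> complex \<Rightarrow> real" where
  "conic_eval K z = (case K of (a,b,c,d,e,f) \<Rightarrow>
     a * (Re z)^2 + b * Re z * Im z + c * (Im z)^2 + d * Re z + e * Im z + f)"

definition quad_coeff :: "conic \<Rightarrow> complex" where
  "quad_coeff K = (case K of (a,b,c,d,e,f) \<Rightarrow> Complex ((a - c) / 4) (- b / 4))"

definition herm_coeff :: "conic \<Rightarrow> real" where
  "herm_coeff K = (case K of (a,b,c,d,e,f) \<Rightarrow> (a + c) / 2)"

definition lin_coeff :: "conic \<Rightarrow> complex" where
  "lin_coeff K = (case K of (a,b,c,d,e,f) \<Rightarrow> Complex (d / 2) (- e / 2))"

definition const_coeff :: "conic \<Rightarrow> real" where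
  "const_coeff K = (case K of (a,b,c,d,e,f) \<Rightarrow> f)"

definition hermitian_conic :: "complex \<Rightarrow> real \<Rightarrow> complex \<Rightarrow> real \<Rightarrow> conic" where
  "hermitian_conic \<alpha> \<beta> \<gamma> \<delta> =
     (\<beta> + 2 * Re \<alpha>, - 4 * Im \<alpha>, \<beta> - 2 * Re \<alpha>, 2 * Re \<gamma>, - 2 * Im \<gamma>, \<delta>)"

lemmas conic_coeff_defs = quad_coeff_def herm_coeff_def lin_coeff_def const_coeff_def

lemma hermitian_conic_coeffs [simp]:
  "quad_coeff (hermitian_conic \<alpha> \<beta> \<gamma> \<delta>) = \<alpha>"
  "herm_coeff (hermitian_conic \<alpha> \<beta> \<gamma> \<delta>) = \<beta>"
  "lin_coeff (hermitian_conic \<alpha> \<beta> \<gamma> \<delta>) = \<gamma>"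
  "const_coeff (hermitian_conic \<alpha> \<beta> \<gamma> \<delta>) = \<delta>"
  by (simp_all add: conic_coeff_defs hermitian_conic_def complex_eq_iff)

lemma conic_eqI:
  assumes "quad_coeff K = quad_coeff L" "herm_coeff K = herm_coeff L"
    "lin_coeff K = lin_coeff L" "const_coeff K = const_coeff L"
  shows "K = L"
  using assms by (cases K; cases L) (auto simp: conic_coeff_defs)

lemma conic_eval_complex:
  "of_real (conic_eval K z) = quad_coeff K * z^2 + cnj (quad_coeff K) * (cnj z)^2
     + of_real (herm_coeff K) * z * cnj z + lin_coeff K * z + cnj (lin_coeff K) * cnj z
     + of_real (const_coeff K)"
  by (cases K)
    (simp add: conic_eval_def conic_coeff_defs complex_eq_iff power2_eq_square field_simps)

lemma conic_grad_complex:
  "cnj (conic_grad K z)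
     = 2 * (2 * quad_coeff K * z + of_real (herm_coeff K) * cnj z + lin_coeff K)"
  by (cases K) (simp add: conic_grad_def conic_coeff_defs complex_eq_iff field_simps)

lemma on_conic_iff: "on_conic K z \<longleftrightarrow> conic_eval K z = 0"
  by (simp add: on_conic_def conic_eval_def split: prod.splits)

lemma on_conic_complex_iff:
  "on_conic K z \<longleftrightarrow> quad_coeff K * z^2 + cnj (quad_coeff K) * (cnj z)^2
     + of_real (herm_coeff K) * z * cnj z + lin_coeff K * z + cnj (lin_coeff K) * cnj z
     + of_real (const_coeff K) = 0"
  unfolding on_conic_iff conic_eval_complex[symmetric] by simp

lemma is_conic_iff: "is_conic K \<longleftrightarrow> quad_coeff K \<noteq> 0 \<or> herm_coeff K \<noteq> 0"
  by (cases K) (auto simp: is_conic_def conic_coeff_defs complex_eq_iff)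

lemma is_circle_iff:
  "is_circle K \<longleftrightarrow> quad_coeff K = 0 \<and> herm_coeff K \<noteq> 0 \<and>
     (cmod (lin_coeff K))^2 > herm_coeff K * const_coeff K"
  by (cases K)
    (auto simp: is_circle_def conic_coeff_defs complex_eq_iff cmod_def power_divide field_simps)

lemma is_circle_sphere:
  assumes "is_circle K"
  obtains z0 r where "r > 0" "\<And>z. on_conic K z \<longleftrightarrow> dist z0 z = r"
proof -
  define \<beta> \<gamma> \<delta> where "\<beta> = herm_coeff K" and "\<gamma> = lin_coeff K" and "\<delta> = const_coeff K"
  have K: "quad_coeff K = 0" "\<beta> \<noteq> 0" "(cmod \<gamma>)^2 - \<beta> * \<delta> > 0"
    using assms by (simp_all add: is_circle_iff \<beta>_def \<gamma>_def \<delta>_def)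
  define z0 R where "z0 = - cnj \<gamma> / of_real \<beta>" and "R = ((cmod \<gamma>)^2 - \<beta> * \<delta>) / \<beta>^2"
  have "R > 0" using K by (simp add: R_def)
  have "on_conic K z \<longleftrightarrow> dist z0 z = sqrt R" for z
  proof -
    have "complex_of_real (\<beta> * conic_eval K z) = of_real (\<beta>^2 * ((dist z0 z)^2 - R))"
    proof -
      have "complex_of_real (\<beta>^2 * R) = \<gamma> * cnj \<gamma> - of_real \<beta> * of_real \<delta>"
        using K(2) complex_norm_square[of \<gamma>] by (simp add: R_def)
      moreover have "of_real \<beta> * z0 = - cnj \<gamma>" "of_real \<beta> * cnj z0 = - \<gamma>"
        using K(2) by (simp_all add: z0_def)
      moreover have "complex_of_real ((dist z0 z)^2) = (z0 - z) * (cnj z0 - cnj z)"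
        unfolding dist_norm complex_norm_square by simp
      ultimately show ?thesis
        unfolding of_real_mult of_real_diff of_real_power conic_eval_complex K(1)
          \<beta>_def[symmetric] \<gamma>_def[symmetric] \<delta>_def[symmetric] complex_cnj_zero by algebra
    qed
    hence "\<beta> * conic_eval K z = \<beta>^2 * ((dist z0 z)^2 - R)" by (simp only: of_real_eq_iff)
    hence "on_conic K z \<longleftrightarrow> (dist z0 z)^2 = R" using K(2) by (auto simp: on_conic_iff)
    also have "\<dots> \<longleftrightarrow> dist z0 z = sqrt R"
      using \<open>R > 0\<close> by (auto simp: real_sqrt_unique)
    finally show ?thesis .
  qed
  thus thesis using that[of "sqrt R" z0] \<open>R > 0\<close> by simp
qed

lemma conic_scale_eq_scaleR: "conic_scale t K = t *\<^sub>R K"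
  by (cases K) (simp add: conic_scale_def)

lemma conic_add_scaleR:
  "quad_coeff (t *\<^sub>R K + L) = of_real t * quad_coeff K + quad_coeff L"
  "conic_eval (t *\<^sub>R K + L) z = t * conic_eval K z + conic_eval L z"
  "conic_grad (t *\<^sub>R K + L) z = of_real t * conic_grad K z + conic_grad L z"
  by (cases K; cases L; simp add: quad_coeff_def conic_eval_def conic_grad_def complex_eq_iff
      field_simps)+

definition double_line :: "complex \<Rightarrow> complex \<Rightarrow> conic" where
  "double_line P w = (let n = Im (cnj w * P) in
     ((Im w)^2, - 2 * Re w * Im w, (Re w)^2, 2 * n * Im w, - 2 * n * Re w, n^2))"

lemma double_line_eval: "conic_eval (double_line P w) z = (Im (cnj w * (z - P)))^2"
  by (simp add: conic_eval_def double_line_def Let_def power2_eq_square algebra_simps)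

lemma double_line_grad:
  "conic_grad (double_line P w) z = 2 * of_real (Im (cnj w * (z - P))) * (\<i> * w)"
  by (simp add: conic_grad_def double_line_def Let_def complex_eq_iff power2_eq_square
      algebra_simps)

lemma double_line_quad_coeff: "quad_coeff (double_line P w) = - ((cnj w)^2 / 4)"
  by (simp add: quad_coeff_def double_line_def Let_def complex_eq_iff power2_eq_square field_simps)

lemma is_conic_circle_plus_double_line:
  assumes "is_circle \<Gamma>" "w \<noteq> 0"
  shows "is_conic (s *\<^sub>R \<Gamma> + double_line P w)"
  using assms
  by (simp add: is_conic_iff is_circle_iff conic_add_scaleR double_line_quad_coeff)

lemma curves_tangent_at_double_contact:
  assumes "on_conic \<Gamma> z" "Im (cnj w * (z - P)) = 0"
  shows "curves_tangent_at \<Gamma> (s *\<^sub>R \<Gamma> + double_line P w) z"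
  using assms
  by (simp add: curves_tangent_at_def on_conic_iff conic_add_scaleR double_line_eval
      double_line_grad)

lemma curves_tangent_at_scaleR:
  assumes "curves_tangent_at K L z"
  shows "curves_tangent_at K (t *\<^sub>R L) z"
proof -
  have "conic_eval (t *\<^sub>R L) z = t * conic_eval L z"
    "conic_grad (t *\<^sub>R L) z = of_real t * conic_grad L z"
    by (cases L; simp add: conic_eval_def conic_grad_def complex_eq_iff field_simps)+
  thus ?thesis
    using assms by (simp add: curves_tangent_at_def on_conic_iff mult.left_commute)
qed

lemma unique_conic5_tangentI:
  assumes "unique_conic5 p1 p2 p3 p4 p5" "is_conic K" "\<forall>p\<in>{p1,p2,p3,p4,p5}. on_conic K p"
    and "is_conic L" "\<forall>p\<in>{p1,p2,p3,p4,p5}. on_conic L p" "curves_tangent_at \<Gamma> L z"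
  shows "curves_tangent_at \<Gamma> K z"
proof -
  obtain t where "K = conic_scale t L"
    using assms(1-5) unfolding unique_conic5_def by blast
  thus ?thesis using assms(6) by (simp add: conic_scale_eq_scaleR curves_tangent_at_scaleR)
qed

lemma quartic_vieta:
  fixes c4 c3 c2 c1 c0 :: "'a::idom"
  assumes roots: "\<And>z. z \<in> {r1, r2, r3, r4} \<Longrightarrow> c4 * z^4 + c3 * z^3 + c2 * z^2 + c1 * z + c0 = 0"
    and distinct: "distinct [r1, r2, r3, r4]"
  shows "c3 = - c4 * (r1 + r2 + r3 + r4)"
    and "c2 = c4 * (r1 * r2 + r1 * r3 + r1 * r4 + r2 * r3 + r2 * r4 + r3 * r4)"
    and "c0 = c4 * (r1 * r2 * r3 * r4)"
proof -
  define p q where "p = [:c0, c1, c2, c3, c4:]"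
    and "q = smult c4 ([:- r1, 1:] * [:- r2, 1:] * [:- r3, 1:] * [:- r4, 1:])"
  have "p = q"
  proof (rule poly_eqI_degree_lead_coeff)
    show "coeff p 4 = coeff q 4" by (simp add: p_def q_def numeral_eq_Suc)
    show "4 \<le> card {r1, r2, r3, r4}" using distinct by simp
    show "degree p \<le> 4" "degree q \<le> 4"
      by (auto simp: p_def q_def intro!: degree_le simp: numeral_eq_Suc)
    fix z assume "z \<in> {r1, r2, r3, r4}"
    moreover have "poly q z = c4 * ((z - r1) * (z - r2) * (z - r3) * (z - r4))"
      unfolding q_def poly_smult poly_mult poly_pCons poly_0 by algebra
    moreover have "poly p z = c4 * z^4 + c3 * z^3 + c2 * z^2 + c1 * z + c0"
      unfolding p_def poly_pCons poly_0 by algebra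
    ultimately show "poly p z = poly q z"
      using roots by auto
  qed
  thus "c3 = - c4 * (r1 + r2 + r3 + r4)" "c0 = c4 * (r1 * r2 * r3 * r4)"
    "c2 = c4 * (r1 * r2 + r1 * r3 + r1 * r4 + r2 * r3 + r2 * r4 + r3 * r4)"
    by (auto simp: p_def q_def algebra_simps)
qed

lemma conic_unit_circle_vieta:
  assumes "\<And>t. t \<in> {t1, t2, t3, t4} \<Longrightarrow> cmod t = 1 \<and> on_conic K t" "distinct [t1, t2, t3, t4]"
  shows "lin_coeff K = - quad_coeff K * (t1 + t2 + t3 + t4)"
    and "of_real (herm_coeff K) + of_real (const_coeff K)
      = quad_coeff K * (t1 * t2 + t1 * t3 + t1 * t4 + t2 * t3 + t2 * t4 + t3 * t4)"
    and "cnj (quad_coeff K) = quad_coeff K * (t1 * t2 * t3 * t4)"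
proof -
  have "quad_coeff K * t^4 + lin_coeff K * t^3
      + (of_real (herm_coeff K) + of_real (const_coeff K)) * t^2
      + cnj (lin_coeff K) * t + cnj (quad_coeff K) = 0" if "t \<in> {t1, t2, t3, t4}" for t
    using assms(1)[OF that] unfolding cmod_eq_1_iff on_conic_complex_iff by algebra
  from quartic_vieta[OF this assms(2)]
  show "lin_coeff K = - quad_coeff K * (t1 + t2 + t3 + t4)"
    "of_real (herm_coeff K) + of_real (const_coeff K)
      = quad_coeff K * (t1 * t2 + t1 * t3 + t1 * t4 + t2 * t3 + t2 * t4 + t3 * t4)"
    "cnj (quad_coeff K) = quad_coeff K * (t1 * t2 * t3 * t4)" by simp_all
qed

subsection \<open>Change of coordinates by a similarity\<close>

definition chart :: "complex \<Rightarrow> complex \<Rightarrow> complex \<Rightarrow> complex" where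
  "chart z0 \<rho> z = (z - z0) / \<rho>"

lemma chart_diff: "chart z0 \<rho> y - chart z0 \<rho> x = (y - x) / \<rho>"
  by (simp add: chart_def diff_divide_distrib)

definition conic_pullback :: "complex \<Rightarrow> complex \<Rightarrow> conic \<Rightarrow> conic" where
  "conic_pullback z0 \<rho> K = hermitian_conic (quad_coeff K * \<rho>^2) (herm_coeff K * (cmod \<rho>)^2)
     (\<rho> * (2 * quad_coeff K * z0 + of_real (herm_coeff K) * cnj z0 + lin_coeff K))
     (conic_eval K z0)"

lemma conic_pullback_coeffs [simp]:
  "quad_coeff (conic_pullback z0 \<rho> K) = quad_coeff K * \<rho>^2"
  "herm_coeff (conic_pullback z0 \<rho> K) = herm_coeff K * (cmod \<rho>)^2"
  "lin_coeff (conic_pullback z0 \<rho> K)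
     = \<rho> * (2 * quad_coeff K * z0 + of_real (herm_coeff K) * cnj z0 + lin_coeff K)"
  "const_coeff (conic_pullback z0 \<rho> K) = conic_eval K z0"
  by (simp_all add: conic_pullback_def)

lemma conic_eval_pullback: "conic_eval (conic_pullback z0 \<rho> K) z = conic_eval K (z0 + \<rho> * z)"
proof -
  have "complex_of_real (conic_eval (conic_pullback z0 \<rho> K) z)
      = of_real (conic_eval K (z0 + \<rho> * z))"
    unfolding conic_eval_complex conic_pullback_coeffs of_real_mult complex_norm_square
      complex_cnj_add complex_cnj_mult complex_cnj_power complex_cnj_complex_of_real
      complex_cnj_cnj complex_cnj_numeral by algebra
  thus ?thesis by (simp only: of_real_eq_iff)
qed

lemma conic_grad_pullback:
  "conic_grad (conic_pullback z0 \<rho> K) z = cnj \<rho> * conic_grad K (z0 + \<rho> * z)"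
proof -
  have "cnj (conic_grad (conic_pullback z0 \<rho> K) z) = \<rho> * cnj (conic_grad K (z0 + \<rho> * z))"
    unfolding conic_grad_complex conic_pullback_coeffs of_real_mult complex_norm_square
      complex_cnj_add complex_cnj_mult by algebra
  thus ?thesis by (metis complex_cnj_cnj complex_cnj_mult)
qed

lemma on_conic_pullback: "on_conic (conic_pullback z0 \<rho> K) z \<longleftrightarrow> on_conic K (z0 + \<rho> * z)"
  by (simp add: on_conic_iff conic_eval_pullback)

lemma conic_pullback_scaleR: "conic_pullback z0 \<rho> (t *\<^sub>R K) = t *\<^sub>R conic_pullback z0 \<rho> K"
  by (cases K) (simp add: conic_pullback_def hermitian_conic_def conic_coeff_defs conic_eval_def
      power2_eq_square field_simps)

lemma conic_pullback_chart:
  assumes "\<rho> \<noteq> 0"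
  shows "conic_pullback z0 \<rho> (conic_pullback (- z0 / \<rho>) (1 / \<rho>) K) = K"
proof (rule conic_eqI)
  have \<rho>: "complex_of_real ((cmod \<rho>)^2) = \<rho> * cnj \<rho>" by (rule complex_norm_square)
  show "lin_coeff (conic_pullback z0 \<rho> (conic_pullback (- z0 / \<rho>) (1 / \<rho>) K)) = lin_coeff K"
    using assms \<rho> by (simp add: norm_divide power_divide field_simps power2_eq_square)
  have "const_coeff K = conic_eval K 0" by (cases K) (simp add: conic_eval_def const_coeff_def)
  thus "const_coeff (conic_pullback z0 \<rho> (conic_pullback (- z0 / \<rho>) (1 / \<rho>) K)) = const_coeff K"
    by (simp add: conic_eval_pullback)
qed (use assms in \<open>simp_all add: norm_divide power_divide\<close>)

context
  fixes z0 \<rho> :: complex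
  assumes \<rho>: "\<rho> \<noteq> 0"
begin

lemma chart_inverse: "z0 + \<rho> * chart z0 \<rho> z = z"
  using \<rho> by (simp add: chart_def)

lemma chart_eq_iff: "chart z0 \<rho> z = chart z0 \<rho> w \<longleftrightarrow> z = w"
  using \<rho> by (simp add: chart_def)

lemma collinear_chart:
  "collinear {chart z0 \<rho> u, chart z0 \<rho> v, chart z0 \<rho> w} \<longleftrightarrow> collinear {u, v, w}"
  using \<rho> unfolding collinear_complex_iff chart_diff by (simp add: mult.commute[of \<rho>])

lemma isogonal_conj_chart:
  assumes "\<not> collinear {A, B, C}"
  shows "isogonal_conj (chart z0 \<rho> A) (chart z0 \<rho> B) (chart z0 \<rho> C) (chart z0 \<rho> P) (chart z0 \<rho> P')
    \<longleftrightarrow> isogonal_conj A B C P P'"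
  using assms \<rho> by (simp add: isogonal_conj_iff collinear_chart chart_diff)

lemma on_conic_chart: "on_conic (conic_pullback z0 \<rho> K) (chart z0 \<rho> z) \<longleftrightarrow> on_conic K z"
  by (simp add: on_conic_pullback chart_inverse)

lemma is_conic_pullback: "is_conic (conic_pullback z0 \<rho> K) \<longleftrightarrow> is_conic K"
  using \<rho> by (simp add: is_conic_iff)

lemma is_circle_pullback:
  assumes "is_circle K"
  shows "is_circle (conic_pullback z0 \<rho> K)"
proof -
  define \<beta> \<gamma> where "\<beta> = herm_coeff K" and "\<gamma> = lin_coeff K"
  have K: "quad_coeff K = 0" using assms by (simp add: is_circle_iff)
  have "complex_of_real ((cmod (of_real \<beta> * cnj z0 + \<gamma>))^2 - \<beta> * conic_eval K z0)
      = of_real ((cmod \<gamma>)^2 - \<beta> * const_coeff K)"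
    unfolding of_real_diff of_real_mult conic_eval_complex complex_norm_square K complex_cnj_add
      complex_cnj_mult complex_cnj_zero complex_cnj_cnj complex_cnj_complex_of_real \<beta>_def \<gamma>_def
    by algebra
  hence "(cmod (of_real \<beta> * cnj z0 + \<gamma>))^2 - \<beta> * conic_eval K z0 = (cmod \<gamma>)^2 - \<beta> * const_coeff K"
    by (simp only: of_real_eq_iff)
  also have "\<dots> > 0" using assms by (simp add: is_circle_iff \<beta>_def \<gamma>_def)
  finally have "\<beta> * conic_eval K z0 < (cmod (of_real \<beta> * cnj z0 + \<gamma>))^2" by simp
  hence "(cmod \<rho>)^2 * (\<beta> * conic_eval K z0) < (cmod \<rho>)^2 * (cmod (of_real \<beta> * cnj z0 + \<gamma>))^2"
    using \<rho> by simp
  thus ?thesis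
    using assms \<rho> by (simp add: is_circle_iff norm_mult power_mult_distrib \<beta>_def \<gamma>_def mult_ac)
qed

lemma curves_tangent_at_chart:
  "curves_tangent_at (conic_pullback z0 \<rho> K) (conic_pullback z0 \<rho> L) (chart z0 \<rho> z)
    \<longleftrightarrow> curves_tangent_at K L z"
proof -
  have "cnj (cnj \<rho> * g) * (cnj \<rho> * h) = (cmod \<rho>)^2 *\<^sub>R (cnj g * h)" for g h
    unfolding scaleR_conv_of_real complex_norm_square by simp
  hence "Im (cnj (cnj \<rho> * g) * (cnj \<rho> * h)) = (cmod \<rho>)^2 * Im (cnj g * h)" for g h
    by (simp only: scaleR_complex.sel)
  thus ?thesis
    using \<rho> by (simp add: curves_tangent_at_def on_conic_chart conic_grad_pullback chart_inverse
        del: complex_cnj_mult)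
qed

lemma line_tangent_at_chart:
  "line_tangent_at (chart z0 \<rho> u) (chart z0 \<rho> v) (conic_pullback z0 \<rho> K) (chart z0 \<rho> z)
    \<longleftrightarrow> line_tangent_at u v K z"
proof -
  have "cnj (cnj \<rho> * g) * (chart z0 \<rho> v - chart z0 \<rho> u) = cnj g * (v - u)" for g
    using \<rho> by (simp add: chart_diff)
  thus ?thesis
    by (simp only: line_tangent_at_def chart_eq_iff collinear_chart on_conic_chart
        conic_grad_pullback chart_inverse)
qed

lemma unique_conic5_chart:
  assumes "unique_conic5 p1 p2 p3 p4 p5"
  shows "unique_conic5 (chart z0 \<rho> p1) (chart z0 \<rho> p2) (chart z0 \<rho> p3)
    (chart z0 \<rho> p4) (chart z0 \<rho> p5)"
proof -
  define through where "through S K \<longleftrightarrow> is_conic K \<and> (\<forall>p\<in>S. on_conic K p)" for S K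
  define S where "S = {p1, p2, p3, p4, p5}"
  have pullback: "through (chart z0 \<rho> ` S) (conic_pullback z0 \<rho> K) \<longleftrightarrow> through S K" for K
    by (simp add: through_def is_conic_pullback on_conic_chart)
  have surj: "\<exists>K. K' = conic_pullback z0 \<rho> K" for K'
    using conic_pullback_chart[OF \<rho>, symmetric] by blast
  have "\<exists>K. through S K"
    and uniq: "\<And>K L. through S K \<Longrightarrow> through S L \<Longrightarrow> \<exists>t. t \<noteq> 0 \<and> L = t *\<^sub>R K"
    using assms by (auto simp: unique_conic5_def through_def S_def conic_scale_eq_scaleR)
  hence "\<exists>K'. through (chart z0 \<rho> ` S) K'" using pullback by blast
  moreover have "\<exists>t. t \<noteq> 0 \<and> L' = t *\<^sub>R K'"
    if K'L': "through (chart z0 \<rho> ` S) K'" "through (chart z0 \<rho> ` S) L'" for K' L'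
  proof -
    obtain K L where KL: "K' = conic_pullback z0 \<rho> K" "L' = conic_pullback z0 \<rho> L"
      using surj by metis
    with K'L' pullback uniq obtain t where "t \<noteq> 0" "L = t *\<^sub>R K" by blast
    thus ?thesis using KL conic_pullback_scaleR by blast
  qed
  moreover have "chart z0 \<rho> ` S = {chart z0 \<rho> p1, chart z0 \<rho> p2, chart z0 \<rho> p3,
      chart z0 \<rho> p4, chart z0 \<rho> p5}"
    by (simp add: S_def)
  ultimately show ?thesis
    unfolding unique_conic5_def through_def conic_scale_eq_scaleR by metis
qed

lemmas chart_transfer = chart_eq_iff collinear_chart isogonal_conj_chart on_conic_chart
  is_conic_pullback is_circle_pullback curves_tangent_at_chart line_tangent_at_chart
  unique_conic5_chart

end

lemma circle_chart:
  assumes "is_circle K" "on_conic K D"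
  obtains z0 \<rho> where "\<rho> \<noteq> 0" "chart z0 \<rho> D = 1" "\<And>z. on_conic K z \<longleftrightarrow> cmod (chart z0 \<rho> z) = 1"
proof -
  obtain z0 r where r: "r > 0" "\<And>z. on_conic K z \<longleftrightarrow> dist z0 z = r"
    using is_circle_sphere[OF assms(1)] by metis
  hence D: "cmod (D - z0) = r" using assms(2) by (simp add: dist_norm norm_minus_commute)
  show thesis
  proof (rule that)
    show "D - z0 \<noteq> 0" using D r(1) by auto
    thus "chart z0 (D - z0) D = 1" by (simp add: chart_def)
    show "on_conic K z \<longleftrightarrow> cmod (chart z0 (D - z0) z) = 1" for z
      using r D by (auto simp: chart_def norm_divide dist_norm norm_minus_commute field_simps)
  qed
qed

subsection \<open>Circumconics of a triangle inscribed in the unit circle\<close>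

lemma isogonal_line_unit_iff:
  fixes a b c p q :: complex
  assumes "cmod a = 1" "cmod b = 1" "cmod c = 1" "a \<noteq> b" "c \<noteq> a"
  defines "N \<equiv> p + q + a * b * c * cnj p * cnj q - (a + b + c)"
  shows "(p - a) * (q - a) / ((b - a) * (c - a)) \<in> \<real> \<longleftrightarrow> a * b * c * cnj N = a * N"
proof -
  define T where "T = (b - a) * (c - a)"
  have unit: "a * cnj a = 1" "b * cnj b = 1" "c * cnj c = 1"
    using assms(1-3) by (simp_all add: cmod_eq_1_iff)
  have "T = a^2 * b * c * cnj T"
    using unit unfolding T_def complex_cnj_mult complex_cnj_diff by algebra
  hence "T * cnj ((p - a) * (q - a)) - cnj T * ((p - a) * (q - a))
      = cnj T * (a * N - a * b * c * cnj N)"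
    using unit unfolding N_def complex_cnj_mult complex_cnj_diff complex_cnj_add complex_cnj_cnj
    by algebra
  moreover have "T \<noteq> 0" using assms(4,5) by (simp add: T_def)
  ultimately show ?thesis unfolding T_def[symmetric]
    by (metis complex_cnj_zero_iff divide_in_Reals_iff eq_iff_diff_eq_0 mult_eq_0_iff)
qed

locale unit_triangle =
  fixes a b c :: complex
  assumes vertices_unit: "cmod a = 1" "cmod b = 1" "cmod c = 1"
    and vertices_distinct: "a \<noteq> b" "b \<noteq> c" "c \<noteq> a"
begin

definition s1 :: complex where "s1 = a + b + c"
definition s2 :: complex where "s2 = a * b + b * c + c * a"
definition s3 :: complex where "s3 = a * b * c"

lemma vertices_cnj: "a * cnj a = 1" "b * cnj b = 1" "c * cnj c = 1"
  using vertices_unit by (simp_all add: cmod_eq_1_iff)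

lemma s3_cnj: "s3 * cnj s3 = 1"
  unfolding s3_def complex_cnj_mult using vertices_cnj by algebra

lemma s2_eq_cnj_s1: "s2 = s3 * cnj s1"
  unfolding s1_def s2_def s3_def complex_cnj_add using vertices_cnj by algebra

lemma vertex_polynomial: "(t - a) * (t - b) * (t - c) = t^3 - s1 * t^2 + s2 * t - s3"
  unfolding s1_def s2_def s3_def by algebra

lemma vertices_not_collinear: "\<not> collinear {a, b, c}"
proof
  assume "collinear {a, b, c}"
  hence "c + a * b * cnj c = a + b"
    using collinear_unit_chord_iff vertices_unit vertices_distinct(1) by blast
  hence "(c - a) * (c - b) = 0" using vertices_cnj by algebra
  thus False using vertices_distinct by simp
qed

lemma isogonal_conj_iff_unit:
  "isogonal_conj a b c p q \<longleftrightarrow> p + q + s3 * cnj p * cnj q = s1"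
proof -
  define N where "N = p + q + s3 * cnj p * cnj q - s1"
  have "isogonal_conj a b c p q \<longleftrightarrow> s3 * cnj N = a * N \<and> s3 * cnj N = b * N \<and> s3 * cnj N = c * N"
    using isogonal_line_unit_iff[of a b c p q] isogonal_line_unit_iff[of b c a p q]
      isogonal_line_unit_iff[of c a b p q] vertices_unit vertices_distinct
    unfolding isogonal_conj_iff[OF vertices_not_collinear] N_def s1_def s3_def
    by (simp add: ac_simps)
  also have "\<dots> \<longleftrightarrow> N = 0" using vertices_distinct(1) by auto
  finally show ?thesis by (simp add: N_def)
qed

definition circumconic :: "conic \<Rightarrow> bool" where
  "circumconic K \<longleftrightarrow> is_conic K \<and> on_conic K a \<and> on_conic K b \<and> on_conic K c"

lemma circumconic_coeffs:
  assumes "circumconic K" "cmod d = 1" "on_conic K d" "d \<notin> {a, b, c}"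
  shows "lin_coeff K = - quad_coeff K * (s1 + d)"
    and "of_real (herm_coeff K) + of_real (const_coeff K) = quad_coeff K * (s2 + d * s1)"
    and "cnj (quad_coeff K) = d * s3 * quad_coeff K"
proof -
  have "cmod t = 1 \<and> on_conic K t" if "t \<in> {a, b, c, d}" for t
    using that assms vertices_unit by (auto simp: circumconic_def)
  moreover have "distinct [a, b, c, d]" using assms(4) vertices_distinct by auto
  ultimately show "lin_coeff K = - quad_coeff K * (s1 + d)"
    "of_real (herm_coeff K) + of_real (const_coeff K) = quad_coeff K * (s2 + d * s1)"
    "cnj (quad_coeff K) = d * s3 * quad_coeff K"
    using conic_unit_circle_vieta[of a b c d K]
    by (simp_all add: s1_def s2_def s3_def algebra_simps)
qed

end

locale isogonal_pair = unit_triangle +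
  fixes p q :: complex
  assumes isogonal: "isogonal_conj a b c p q"
begin

lemma isogonal_pair_swap: "isogonal_pair a b c q p"
  using isogonal isogonal_conj_commute[OF vertices_not_collinear] by unfold_locales blast

lemma s1_isogonal: "s1 = p + q + s3 * cnj p * cnj q"
  using isogonal by (simp add: isogonal_conj_iff_unit)

lemma cnj_s1_isogonal: "cnj s1 = cnj p + cnj q + cnj s3 * p * q"
  unfolding s1_isogonal by simp

lemma s2_isogonal: "s2 = s3 * (cnj p + cnj q) + p * q"
  using s2_eq_cnj_s1 cnj_s1_isogonal s3_cnj by algebra

lemma circumconic_through_isogonal_point:
  assumes K: "circumconic K" "cmod d = 1" "on_conic K d" "d \<notin> {a, b, c}"
    and p: "on_conic K p" "cmod p \<noteq> 1"
  shows "of_real (herm_coeff K) = quad_coeff K * (s3 * cnj q + d * q)" and "quad_coeff K \<noteq> 0"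
proof -
  define \<alpha> \<beta> where "\<alpha> = quad_coeff K" and "\<beta> = complex_of_real (herm_coeff K)"
  note coeffs = circumconic_coeffs[OF K, folded \<alpha>_def \<beta>_def]
  have d: "d * cnj d = 1" using K(2) by (simp add: cmod_eq_1_iff)
  have "cnj (lin_coeff K) = - cnj \<alpha> * (cnj s1 + cnj d)" unfolding coeffs(1) by simp
  hence "(p * cnj p - 1) * (\<beta> - \<alpha> * (s3 * cnj q + d * q)) = 0"
    using p(1) coeffs d s3_cnj s1_isogonal cnj_s1_isogonal s2_isogonal
    unfolding on_conic_complex_iff \<alpha>_def[symmetric] \<beta>_def[symmetric] by algebra
  thus \<beta>: "of_real (herm_coeff K) = quad_coeff K * (s3 * cnj q + d * q)"
    using p(2) by (simp add: cmod_eq_1_iff \<alpha>_def \<beta>_def)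
  show "quad_coeff K \<noteq> 0" using K(1) \<beta> by (auto simp: circumconic_def is_conic_iff)
qed

end

locale isogonal_circumconic = isogonal_pair +
  fixes Q :: conic
  assumes Q_circumconic: "circumconic Q"
    and Q_p: "on_conic Q p" and Q_q: "on_conic Q q" and Q_1: "on_conic Q 1"
    and one_not_vertex: "1 \<notin> {a, b, c}"
    and p_neq_q: "p \<noteq> q"
    and p_off_circle: "cmod p \<noteq> 1"
    and p_off_sides: "\<not> collinear {a, b, p}" "\<not> collinear {b, c, p}" "\<not> collinear {c, a, p}"
begin

definition u :: complex where "u = 1 - p"
definition v :: complex where "v = 1 - q"
definition w :: complex where "w = p - q"

lemmas uvw_defs = u_def v_def w_def complex_cnj_diff complex_cnj_one

lemma q_off_circle: "cmod q \<noteq> 1"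
proof
  assume "cmod q = 1"
  hence q: "q * cnj q = 1" by (simp add: cmod_eq_1_iff)
  have "(q - a) * (q - b) * (q - c) = 0"
    using q s1_isogonal s2_isogonal unfolding vertex_polynomial by algebra
  hence "q = a \<or> q = b \<or> q = c" by simp
  moreover have "p + b * c * cnj p = b + c" if "q = a"
    using s1_isogonal[unfolded that s1_def s3_def] vertices_cnj by algebra
  moreover have "p + c * a * cnj p = c + a" if "q = b"
    using s1_isogonal[unfolded that s1_def s3_def] vertices_cnj by algebra
  moreover have "p + a * b * cnj p = a + b" if "q = c"
    using s1_isogonal[unfolded that s1_def s3_def] vertices_cnj by algebra
  ultimately show False
    using p_off_sides vertices_unit vertices_distinct collinear_unit_chord_iff by blast
qed

lemma uvw_nonzero: "u \<noteq> 0" "v \<noteq> 0" "w \<noteq> 0"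
  using p_off_circle q_off_circle p_neq_q by (auto simp: u_def v_def w_def)

lemma Q_coeffs:
  "cnj (quad_coeff Q) = s3 * quad_coeff Q"
  "lin_coeff Q = - quad_coeff Q * (s1 + 1)"
  "of_real (herm_coeff Q) = quad_coeff Q * (s3 * cnj q + q)"
  using circumconic_coeffs[OF Q_circumconic norm_one Q_1 one_not_vertex]
    circumconic_through_isogonal_point[OF Q_circumconic norm_one Q_1 one_not_vertex Q_p
      p_off_circle]
  by simp_all

lemma s3_cnj_w: "s3 * cnj w = - w"
proof -
  interpret qp: isogonal_pair a b c q p by (rule isogonal_pair_swap)
  have "quad_coeff Q * (s3 * cnj q + q) = quad_coeff Q * (s3 * cnj p + p)" "quad_coeff Q \<noteq> 0"
    using Q_coeffs(3)
      qp.circumconic_through_isogonal_point[OF Q_circumconic norm_one Q_1 one_not_vertex Q_q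
        q_off_circle]
    by simp_all
  hence "s3 * cnj q + q = s3 * cnj p + p" by simp
  thus ?thesis unfolding w_def complex_cnj_diff by algebra
qed

lemma vertex_relation:
  assumes "t \<in> {a, b, c}"
  shows "(t - p) * (t - q) * cnj w + t * w * cnj ((t - p) * (t - q)) = 0"
proof -
  have t: "t * cnj t = 1" using assms vertices_cnj by auto
  have "t^3 - s1 * t^2 + s2 * t - s3 = 0" using assms unfolding vertex_polynomial[symmetric] by auto
  hence "t * ((t - p) * (t - q) * cnj w + t * w * cnj ((t - p) * (t - q))) = 0"
    using t s1_isogonal s2_isogonal s3_cnj_w unfolding complex_cnj_mult complex_cnj_diff by algebra
  thus ?thesis using t by auto
qed

end

subsection \<open>The circle \<open>(PXY)\<close>\<close>

lemma circle_unit_circle_vieta: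
  assumes "is_circle K" "cmod s = 1" "cmod t = 1" "s \<noteq> t" "on_conic K s" "on_conic K t"
  shows "cnj (lin_coeff K) = lin_coeff K * s * t"
    and "of_real (herm_coeff K) + of_real (const_coeff K) = - lin_coeff K * (s + t)"
proof -
  define \<gamma> \<epsilon> where "\<gamma> = lin_coeff K"
    and "\<epsilon> = complex_of_real (herm_coeff K) + of_real (const_coeff K)"
  have unit: "s * cnj s = 1" "t * cnj t = 1" using assms(2,3) by (simp_all add: cmod_eq_1_iff)
  have quad: "quad_coeff K = 0" using assms(1) by (simp add: is_circle_iff)
  have "\<gamma> * z^2 + \<epsilon> * z + cnj \<gamma> = 0" if "on_conic K z" "z * cnj z = 1" for z
    using that quad unfolding on_conic_complex_iff \<gamma>_def \<epsilon>_def quad complex_cnj_zero by algebra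
  hence roots: "\<gamma> * s^2 + \<epsilon> * s + cnj \<gamma> = 0" "\<gamma> * t^2 + \<epsilon> * t + cnj \<gamma> = 0"
    using assms(5,6) unit by simp_all
  hence "(s - t) * (\<epsilon> + \<gamma> * (s + t)) = 0" by algebra
  hence "\<epsilon> + \<gamma> * (s + t) = 0" using assms(4) by simp
  thus "\<epsilon> = - \<gamma> * (s + t)" "cnj \<gamma> = \<gamma> * s * t" using roots by algebra+
qed

locale chord_circle = isogonal_circumconic +
  fixes x y :: complex and \<Gamma> :: conic
  assumes x_unit: "cmod x = 1" and x_line: "collinear {1, p, x}" and x_neq_1: "x \<noteq> 1"
    and y_unit: "cmod y = 1" and y_line: "collinear {1, q, y}" and y_neq_1: "y \<noteq> 1"
    and x_neq_y: "x \<noteq> y"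
    and \<Gamma>_circle: "is_circle \<Gamma>"
    and \<Gamma>_p: "on_conic \<Gamma> p" and \<Gamma>_x: "on_conic \<Gamma> x" and \<Gamma>_y: "on_conic \<Gamma> y"
begin

definition \<sigma> :: complex where "\<sigma> = v + cnj v"
definition \<kappa> :: complex where "\<kappa> = \<sigma> - u * cnj v"

lemma cnj_\<sigma>: "cnj \<sigma> = \<sigma>"
  by (simp add: \<sigma>_def)

lemma cnj_\<kappa>: "cnj \<kappa> = \<sigma> - cnj u * v"
  by (simp add: \<kappa>_def cnj_\<sigma>)

lemma xy_cnj: "x * cnj x = 1" "y * cnj y = 1"
  using x_unit y_unit by (simp_all add: cmod_eq_1_iff)

lemma x_chord: "p + x * cnj p = 1 + x" and y_chord: "q + y * cnj q = 1 + y"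
  using x_unit x_line x_neq_1 y_unit y_line y_neq_1
    collinear_unit_chord_iff[of 1 x p] collinear_unit_chord_iff[of 1 y q]
  by (auto simp: insert_commute)

lemma cnj_u_x: "cnj u * x = - u" and cnj_v_y: "cnj v * y = - v"
  using x_chord y_chord unfolding uvw_defs by algebra+

lemma \<sigma>_nonzero: "\<sigma> \<noteq> 0"
proof
  assume "\<sigma> = 0"
  hence "cnj v * (y - 1) = 0" using cnj_v_y unfolding \<sigma>_def by algebra
  thus False using uvw_nonzero y_neq_1 by simp
qed

lemma \<kappa>_nonzero: "\<kappa> \<noteq> 0"
proof
  assume "\<kappa> = 0"
  hence "cnj v * (p - y) = 0" using cnj_v_y unfolding \<kappa>_def \<sigma>_def u_def by algebra
  hence "p = y" using uvw_nonzero by simp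
  thus False using p_off_circle y_unit by simp
qed

text \<open>If \<open>x\<close> were a vertex, the conic \<open>Q\<close> would contain the line through \<open>1\<close>, \<open>p\<close> and \<open>x\<close>,
  and then also \<open>y = x\<close>.\<close>
lemma x_not_vertex: "x \<notin> {a, b, c}"
proof
  assume "x \<in> {a, b, c}"
  hence "(x - p) * (x - p) * (1 + x - q - x * cnj q) = 0"
    using vertex_relation[of x] x_chord xy_cnj
    unfolding w_def complex_cnj_mult complex_cnj_diff by algebra
  moreover have "x \<noteq> p" using x_unit p_off_circle by auto
  ultimately have "1 + x - q - x * cnj q = 0" by simp
  hence "cnj v * (x - y) = 0" using y_chord unfolding uvw_defs by algebra
  thus False using uvw_nonzero x_neq_y by simp
qed

lemma \<Gamma>_eval:
  "\<sigma> * of_real (conic_eval \<Gamma> z) = of_real (herm_coeff \<Gamma>)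
     * (\<sigma> * (z * cnj z - 1) + cnj u * cnj v * z + u * v * cnj z + u * cnj v + cnj u * v)"
proof -
  define \<beta> \<gamma> \<delta> where "\<beta> = complex_of_real (herm_coeff \<Gamma>)" and "\<gamma> = lin_coeff \<Gamma>"
    and "\<delta> = complex_of_real (const_coeff \<Gamma>)"
  have eval: "of_real (conic_eval \<Gamma> z) = \<beta> * z * cnj z + \<gamma> * z + cnj \<gamma> * cnj z + \<delta>" for z
    using \<Gamma>_circle by (simp add: conic_eval_complex is_circle_iff \<beta>_def \<gamma>_def \<delta>_def)
  have vieta: "cnj \<gamma> = \<gamma> * x * y" "\<beta> + \<delta> = - \<gamma> * (x + y)"
    using circle_unit_circle_vieta[OF \<Gamma>_circle x_unit y_unit x_neq_y \<Gamma>_x \<Gamma>_y]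
    by (simp_all add: \<beta>_def \<gamma>_def \<delta>_def)
  have "\<beta> * p * cnj p + \<gamma> * p + cnj \<gamma> * cnj p + \<delta> = 0"
    using \<Gamma>_p by (simp add: on_conic_iff flip: eval)
  hence "(p * cnj p - 1) * (\<beta> * cnj u * cnj v - \<gamma> * \<sigma>) = 0"
    using vieta cnj_u_x cnj_v_y unfolding \<sigma>_def uvw_defs by algebra
  hence \<gamma>: "\<gamma> * \<sigma> = \<beta> * cnj u * cnj v" using p_off_circle by (simp add: cmod_eq_1_iff)
  hence "cnj \<gamma> * \<sigma> = \<beta> * u * v" "\<sigma> * (\<beta> + \<delta>) = \<beta> * (u * cnj v + cnj u * v)"
    using vieta cnj_u_x cnj_v_y by algebra+
  thus ?thesis using \<gamma> unfolding eval \<beta>_def[symmetric] by algebra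
qed

lemma \<Gamma>_eval_vertex:
  assumes "t \<in> {a, b, c}"
  shows "\<sigma> * w * cnj w * of_real (conic_eval \<Gamma> t)
    = - of_real (herm_coeff \<Gamma>) * (cnj w * (t - p) - w * cnj (t - p))^2"
proof -
  define e f where "e = t - p" and "f = t - q"
  have t: "t * cnj t = 1" using assms vertices_cnj by auto
  have w: "w = f - e" by (simp add: w_def e_def f_def)
  have "e * f * cnj w + t * w * (cnj e * cnj f) = 0"
    using vertex_relation[OF assms] by (simp add: e_def f_def)
  hence "w * cnj w * ((e + t * cnj e) * (f + t * cnj f)) = - t * (cnj w * e - w * cnj e)^2"
    unfolding w complex_cnj_diff by algebra
  moreover have "cnj u * cnj v * t + u * v * cnj t + u * cnj v + cnj u * v
      = cnj t * ((e + t * cnj e) * (f + t * cnj f))"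
    using t unfolding e_def f_def uvw_defs by algebra
  ultimately show ?thesis
    using \<Gamma>_eval[of t] t unfolding e_def[symmetric] by algebra
qed

definition double_contact_conic :: conic where
  "double_contact_conic
     = (- Re \<sigma> * (cmod w)^2 / (4 * herm_coeff \<Gamma>)) *\<^sub>R \<Gamma> + double_line p w"

lemma vertex_on_double_contact_conic:
  assumes "t \<in> {a, b, c}"
  shows "on_conic double_contact_conic t"
proof -
  define i where "i = Im (cnj w * (t - p))"
  have "cnj w * (t - p) - w * cnj (t - p) = 2 * \<i> * of_real i"
    by (simp add: i_def complex_eq_iff algebra_simps)
  moreover have "\<sigma> = of_real (Re \<sigma>)" by (simp add: \<sigma>_def complex_eq_iff)
  ultimately have "of_real (Re \<sigma> * (cmod w)^2 * conic_eval \<Gamma> t)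
      = complex_of_real (4 * herm_coeff \<Gamma> * i^2)"
    using \<Gamma>_eval_vertex[OF assms] complex_norm_square[of w]
    by (simp add: power_mult_distrib mult.assoc)
  hence "Re \<sigma> * (cmod w)^2 * conic_eval \<Gamma> t = 4 * herm_coeff \<Gamma> * i^2"
    by (simp only: of_real_eq_iff)
  moreover have "herm_coeff \<Gamma> \<noteq> 0" using \<Gamma>_circle by (simp add: is_circle_iff)
  ultimately show ?thesis
    unfolding on_conic_iff double_contact_conic_def conic_add_scaleR double_line_eval
      i_def[symmetric]
    by (simp add: field_simps)
qed

theorem conic_through_p_z_tangent:
  assumes z: "on_conic \<Gamma> z" "collinear {p, q, z}"
    and K: "unique_conic5 a b c p z" "circumconic K" "on_conic K p" "on_conic K z"
  shows "curves_tangent_at \<Gamma> K p" "curves_tangent_at \<Gamma> K z"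
proof -
  let ?L = double_contact_conic
  have p: "Im (cnj w * (p - p)) = 0" by simp
  have "Im (cnj (q - p) * (z - p)) = 0"
    using z(2) by (simp add: collinear_complex_iff complex_eq_iff algebra_simps)
  hence z_line: "Im (cnj w * (z - p)) = 0" by (simp add: w_def algebra_simps)
  have tangent: "curves_tangent_at \<Gamma> ?L p" "curves_tangent_at \<Gamma> ?L z"
    unfolding double_contact_conic_def
    using curves_tangent_at_double_contact \<Gamma>_p z(1) p z_line by blast+
  have "is_conic ?L"
    unfolding double_contact_conic_def
    using is_conic_circle_plus_double_line[OF \<Gamma>_circle] uvw_nonzero(3) by blast
  moreover have "\<forall>t\<in>{a, b, c, p, z}. on_conic ?L t"
    using vertex_on_double_contact_conic tangent by (auto simp: curves_tangent_at_def)
  moreover have "is_conic K" "\<forall>t\<in>{a, b, c, p, z}. on_conic K t"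
    using K(2-4) by (auto simp: circumconic_def)
  ultimately show "curves_tangent_at \<Gamma> K p" "curves_tangent_at \<Gamma> K z"
    using unique_conic5_tangentI[OF K(1)] tangent by blast+
qed

text \<open>The similarity inverse to the projection of \<open>\<Gamma>\<close> from \<open>x\<close> to the unit circle.\<close>
definition circle_point :: "complex \<Rightarrow> complex" where
  "circle_point s = (\<kappa> * s - u * v) / \<sigma>"

lemma circle_point_pullback:
  "on_conic (conic_pullback (- (u * v / \<sigma>)) (\<kappa> / \<sigma>) K) s \<longleftrightarrow> on_conic K (circle_point s)"
proof -
  have "- (u * v / \<sigma>) + \<kappa> / \<sigma> * s = circle_point s"
    by (simp add: circle_point_def diff_divide_distrib)
  thus ?thesis by (simp add: on_conic_pullback)
qed

lemma circle_point_eq_p: "circle_point 1 = p"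
proof -
  have "\<kappa> - u * v = \<sigma> * p" unfolding \<kappa>_def \<sigma>_def uvw_defs by algebra
  thus ?thesis using \<sigma>_nonzero by (simp add: circle_point_def)
qed

lemma circle_point_eq_x: "circle_point (x * cnj \<kappa> / \<kappa>) = x"
proof -
  have "x * cnj \<kappa> - u * v = \<sigma> * x" using cnj_u_x cnj_\<kappa> by algebra
  thus ?thesis using \<sigma>_nonzero \<kappa>_nonzero by (simp add: circle_point_def)
qed

lemma circle_point_projection:
  assumes Z: "on_conic \<Gamma> Z" "Z \<noteq> x" and z: "cmod z = 1" "collinear {x, Z, z}" "z \<noteq> x"
  shows "Z = circle_point z"
proof -
  have "Z + x * z * cnj Z = x + z"
    using collinear_unit_chord_iff[of x z Z] x_unit z by (auto simp: insert_commute)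
  moreover have "\<sigma> * (Z * cnj Z - 1) + cnj u * cnj v * Z + u * v * cnj Z
      + u * cnj v + cnj u * v = 0"
    using \<Gamma>_eval[of Z] Z(1) \<Gamma>_circle by (simp add: on_conic_iff is_circle_iff)
  ultimately have "(Z - x) * (\<sigma> * Z - (\<kappa> * z - u * v)) = 0"
    using cnj_u_x unfolding \<kappa>_def by algebra
  hence "\<sigma> * Z = \<kappa> * z - u * v" using Z(2) by simp
  thus ?thesis using \<sigma>_nonzero by (simp add: circle_point_def field_simps)
qed

lemma circle_intersection_vieta:
  assumes K: "on_conic K p" "on_conic K x"
    and z1: "cmod z1 = 1" "on_conic K (circle_point z1)" "circle_point z1 \<notin> {p, x}"
    and z2: "cmod z2 = 1" "on_conic K (circle_point z2)" "circle_point z2 \<notin> {p, x}"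
    and z12: "z1 \<noteq> z2"
  shows "cnj (quad_coeff K) * cnj \<kappa> = quad_coeff K * \<kappa> * x * z1 * z2"
    and "\<sigma> * lin_coeff K - 2 * quad_coeff K * u * v - of_real (herm_coeff K) * cnj u * cnj v
      = - quad_coeff K * (\<kappa> * (1 + z1 + z2) + x * cnj \<kappa>)"
proof -
  define K' where "K' = conic_pullback (- (u * v / \<sigma>)) (\<kappa> / \<sigma>) K"
  define r where "r = x * cnj \<kappa> / \<kappa>"
  have r: "\<kappa> * r = x * cnj \<kappa>" using \<kappa>_nonzero by (simp add: r_def)
  have "cmod r = 1" using x_unit \<kappa>_nonzero by (simp add: r_def norm_mult norm_divide)
  hence "cmod t = 1 \<and> on_conic K' t" if "t \<in> {1, r, z1, z2}" for t
    using that K z1 z2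
    by (auto simp: K'_def circle_point_pullback circle_point_eq_p circle_point_eq_x[folded r_def])
  moreover have "distinct [1, r, z1, z2]"
    using z12 z1(3) z2(3) circle_point_eq_p circle_point_eq_x[folded r_def] x_unit p_off_circle
    by auto
  ultimately have vieta: "lin_coeff K' = - quad_coeff K' * (1 + r + z1 + z2)"
    "cnj (quad_coeff K') = quad_coeff K' * (1 * r * z1 * z2)"
    using conic_unit_circle_vieta[of 1 r z1 z2 K'] by blast+
  have quad: "\<sigma>^2 * quad_coeff K' = \<kappa>^2 * quad_coeff K"
    and lin: "\<sigma>^2 * lin_coeff K' = \<kappa> * (\<sigma> * lin_coeff K - 2 * quad_coeff K * u * v
      - of_real (herm_coeff K) * cnj u * cnj v)"
    using \<sigma>_nonzero by (simp_all add: K'_def cnj_\<sigma> field_simps power2_eq_square)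
  have "\<sigma>^2 * cnj (quad_coeff K') = (cnj \<kappa>)^2 * cnj (quad_coeff K)"
    using arg_cong[OF quad, of cnj] by (simp add: cnj_\<sigma>)
  hence "cnj \<kappa> * (cnj (quad_coeff K) * cnj \<kappa> - quad_coeff K * \<kappa> * x * z1 * z2) = 0"
    using vieta(2) quad r by algebra
  thus "cnj (quad_coeff K) * cnj \<kappa> = quad_coeff K * \<kappa> * x * z1 * z2"
    using \<kappa>_nonzero by simp
  have "\<kappa> * (\<sigma> * lin_coeff K - 2 * quad_coeff K * u * v - of_real (herm_coeff K) * cnj u * cnj v)
      = \<kappa> * (- quad_coeff K * (\<kappa> * (1 + z1 + z2) + x * cnj \<kappa>))"
    using vieta(1) quad lin r by algebra
  thus "\<sigma> * lin_coeff K - 2 * quad_coeff K * u * v - of_real (herm_coeff K) * cnj u * cnj v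
      = - quad_coeff K * (\<kappa> * (1 + z1 + z2) + x * cnj \<kappa>)"
    by (simp only: mult_left_cancel[OF \<kappa>_nonzero])
qed

lemma circle_intersection_chord:
  assumes K: "circumconic K" "on_conic K p" "on_conic K x"
    and z1: "cmod z1 = 1" "on_conic K (circle_point z1)" "circle_point z1 \<notin> {p, x}"
    and z2: "cmod z2 = 1" "on_conic K (circle_point z2)" "circle_point z2 \<notin> {p, x}"
    and z12: "z1 \<noteq> z2"
  shows "\<kappa> * z1 * z2 = s3 * cnj \<kappa>" and "q + z1 * z2 * cnj q = z1 + z2"
proof -
  define \<alpha> \<beta> where "\<alpha> = quad_coeff K" and "\<beta> = complex_of_real (herm_coeff K)"
  note coeffs = circumconic_coeffs[OF K(1) x_unit K(3) x_not_vertex, folded \<alpha>_def]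
  note \<beta> = circumconic_through_isogonal_point[OF K(1) x_unit K(3) x_not_vertex K(2) p_off_circle,
      folded \<alpha>_def \<beta>_def]
  note vieta = circle_intersection_vieta[OF K(2,3) z1 z2 z12, folded \<alpha>_def \<beta>_def]
  have "\<alpha> * x * (\<kappa> * z1 * z2 - s3 * cnj \<kappa>) = 0" using vieta(1) coeffs(3) by algebra
  thus prod: "\<kappa> * z1 * z2 = s3 * cnj \<kappa>" using \<beta>(2) x_unit by auto
  have "\<alpha> * (\<kappa> * (1 + z1 + z2) + x * cnj \<kappa> - 2 * u * v - (s3 * cnj q + x * q) * cnj u * cnj v
      - (x + s1) * \<sigma>) = 0"
    using vieta(2) unfolding coeffs(1) \<beta>(1) by algebra
  hence "\<kappa> * (1 + z1 + z2) + x * cnj \<kappa> - 2 * u * v - (s3 * cnj q + x * q) * cnj u * cnj v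
      - (x + s1) * \<sigma> = 0" using \<beta>(2) by simp
  hence "\<kappa> * cnj u * cnj w * (q + z1 * z2 * cnj q - (z1 + z2)) = 0"
    using prod cnj_u_x s1_isogonal s3_cnj_w cnj_\<kappa> unfolding \<kappa>_def \<sigma>_def uvw_defs by algebra
  thus "q + z1 * z2 * cnj q = z1 + z2" using uvw_nonzero \<kappa>_nonzero by simp
qed

lemma Q_grad_q: "cnj (conic_grad Q q) = - 2 * quad_coeff Q * \<kappa>"
proof -
  define \<alpha> \<beta> where "\<alpha> = quad_coeff Q" and "\<beta> = complex_of_real (herm_coeff Q)"
  note coeffs = Q_coeffs[folded \<alpha>_def \<beta>_def]
  have "cnj w * (2 * \<alpha> * q + \<beta> * cnj q + lin_coeff Q + \<alpha> * \<kappa>) = 0"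
    using s1_isogonal s3_cnj_w unfolding coeffs(2,3) \<kappa>_def \<sigma>_def uvw_defs by algebra
  hence "2 * \<alpha> * q + \<beta> * cnj q + lin_coeff Q + \<alpha> * \<kappa> = 0" using uvw_nonzero by simp
  thus ?thesis unfolding conic_grad_complex \<alpha>_def[symmetric] \<beta>_def[symmetric] by algebra
qed

lemma line_tangent_at_q:
  assumes z: "cmod z1 = 1" "cmod z2 = 1" "z1 \<noteq> z2"
    and prod: "\<kappa> * z1 * z2 = s3 * cnj \<kappa>" and chord: "q + z1 * z2 * cnj q = z1 + z2"
  shows "line_tangent_at z1 z2 Q q"
proof -
  define \<alpha> n where "\<alpha> = quad_coeff Q" and "n = cnj (conic_grad Q q) * (z2 - z1)"
  have unit: "z1 * cnj z1 = 1" "z2 * cnj z2 = 1" using z by (simp_all add: cmod_eq_1_iff)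
  have \<alpha>: "cnj \<alpha> = s3 * \<alpha>" unfolding \<alpha>_def by (rule Q_coeffs(1))
  have n: "n = - 2 * \<alpha> * \<kappa> * (z2 - z1)" by (simp add: n_def Q_grad_q \<alpha>_def)
  hence "cnj n = - 2 * cnj \<alpha> * cnj \<kappa> * (cnj z2 - cnj z1)" by simp
  hence "z1 * z2 * (n + cnj n) = 0" using n \<alpha> prod unit by algebra
  hence "n + cnj n = 0" using unit by auto
  hence "Re n = 0" by (simp add: complex_eq_iff)
  moreover have "collinear {z1, z2, q}" using collinear_unit_chord_iff[OF z] chord by blast
  ultimately show ?thesis using z(3) Q_q by (simp add: line_tangent_at_def n_def)
qed

theorem projected_intersections_line_tangent:
  assumes K: "circumconic K" "on_conic K p" "on_conic K x"
    and Z1: "on_conic \<Gamma> Z1" "on_conic K Z1" "Z1 \<notin> {p, x}"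
    and Z2: "on_conic \<Gamma> Z2" "on_conic K Z2" "Z2 \<notin> {p, x}"
    and z1: "cmod z1 = 1" "collinear {x, Z1, z1}" "z1 \<noteq> x"
    and z2: "cmod z2 = 1" "collinear {x, Z2, z2}" "z2 \<noteq> x"
    and z12: "z1 \<noteq> z2"
  shows "line_tangent_at z1 z2 Q q"
proof -
  have "Z1 = circle_point z1" "Z2 = circle_point z2"
    using circle_point_projection Z1 Z2 z1 z2 by blast+
  thus ?thesis
    using line_tangent_at_q[OF z1(1) z2(1) z12]
      circle_intersection_chord[OF K z1(1) _ _ z2(1) _ _ z12]
      Z1 Z2 by blast
qed

end

theorem theorem1p2:
  fixes A B C P P' D X Y Z :: complex and \<Omega> Q \<Gamma> :: conic
  assumes tri: "\<not> collinear {A, B, C}"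
    and Om: "is_circle \<Omega>" "on_conic \<Omega> A" "on_conic \<Omega> B" "on_conic \<Omega> C"
    and Pgen: "\<not> collinear {A, B, P}" "\<not> collinear {B, C, P}" "\<not> collinear {C, A, P}"
              "\<not> on_conic \<Omega> P"
    and iso: "isogonal_conj A B C P P'" and PP': "P \<noteq> P'"
    and Qc: "unique_conic5 A B C P P'" "is_conic Q"
            "on_conic Q A" "on_conic Q B" "on_conic Q C" "on_conic Q P" "on_conic Q P'"
    and Dd: "on_conic \<Omega> D" "on_conic Q D" "D \<notin> {A, B, C}"
    and Xd: "on_conic \<Omega> X" "collinear {D, P, X}" "X \<noteq> D"
    and Yd: "on_conic \<Omega> Y" "collinear {D, P', Y}" "Y \<noteq> D"
    and Gc: "\<not> collinear {P, X, Y}" "is_circle \<Gamma>"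
            "on_conic \<Gamma> P" "on_conic \<Gamma> X" "on_conic \<Gamma> Y"
    and Zd: "on_conic \<Gamma> Z" "collinear {P, P', Z}" "Z \<noteq> P"
  shows
    "(unique_conic5 A B C P Z \<longrightarrow>
       (\<forall>K. is_conic K \<and> on_conic K A \<and> on_conic K B \<and> on_conic K C \<and> on_conic K P \<and> on_conic K Z
            \<longrightarrow> curves_tangent_at \<Gamma> K P \<and> curves_tangent_at \<Gamma> K Z))
     \<and>
     (\<forall>K Z1 Z2 Z1' Z2'.
        unique_conic5 A B C P X \<and> is_conic K \<and>
        on_conic K A \<and> on_conic K B \<and> on_conic K C \<and> on_conic K P \<and> on_conic K X \<and>
        on_conic \<Gamma> Z1 \<and> on_conic K Z1 \<and> on_conic \<Gamma> Z2 \<and> on_conic K Z2 \<and>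
        Z1 \<noteq> Z2 \<and> Z1 \<notin> {P, X} \<and> Z2 \<notin> {P, X} \<and>
        on_conic \<Omega> Z1' \<and> collinear {X, Z1, Z1'} \<and> Z1' \<noteq> X \<and>
        on_conic \<Omega> Z2' \<and> collinear {X, Z2, Z2'} \<and> Z2' \<noteq> X \<and>
        Z1' \<noteq> Z2'
        \<longrightarrow> line_tangent_at Z1' Z2' Q P')"
proof -
  obtain z0 \<rho> where \<rho>: "\<rho> \<noteq> 0" and D: "chart z0 \<rho> D = 1"
    and circle: "\<And>z. on_conic \<Omega> z \<longleftrightarrow> cmod (chart z0 \<rho> z) = 1"
    using circle_chart[OF Om(1) Dd(1)] by metis
  let ?\<phi> = "chart z0 \<rho>" and ?F = "conic_pullback z0 \<rho>"
  note [simp] = chart_transfer[OF \<rho>] D[symmetric] circle[symmetric]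
  interpret unit_triangle "?\<phi> A" "?\<phi> B" "?\<phi> C"
    using Om tri by unfold_locales (auto simp: insert_commute)
  interpret chord_circle "?\<phi> A" "?\<phi> B" "?\<phi> C" "?\<phi> P" "?\<phi> P'" "?F Q" "?\<phi> X" "?\<phi> Y" "?F \<Gamma>"
    using assms by unfold_locales (auto simp: circumconic_def)
  note tangent_conics = conic_through_p_z_tangent[of "?\<phi> Z" "?F K" for K]
  note tangent_line = projected_intersections_line_tangent[of "?F K"
      "?\<phi> Z1" "?\<phi> Z2" "?\<phi> Z1'" "?\<phi> Z2'" for K Z1 Z2 Z1' Z2']
  show ?thesis
    using tangent_conics tangent_line Zd by (auto simp: circumconic_def)
qed

end
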